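(* Let $G$ be a nice group. If $\mathcal{K}_1,\mathcal{K}_2$ are finite free $G$-simplicial complexes with $\operatorname{ind}\mathcal{K}_1=\operatorname{ind}\mathcal{K}_2=1$, then $\operatorname{ind}(\mathcal{K}_1\times\mathcal{K}_2)=1$, where $\mathcal{K}_1\times\mathcal{K}_2$ carries the diagonal action $g\cdot(x,y)=(gx,gy)$.
   Context: A finite group $G$ is called nice if it is either a cyclic $p$-group (for some prime $p$) or a generalized quaternion group $Q_{4n}=\langle a,b : a^n=b^2, a^{2n}=1, b^{-1}ab=a^{-1}\rangle$ ($n\ge 2$) whose order is a power of $2$. For a space $X$ with a free action of $G$, the mapping index $\operatorname{ind}X$ is the minimal $k\ge 0$ such that there is a continuous $G$-equivariant map $X\to E_kG$, where $E_kG=G^{*(k+1)}$ is the $(k+1)$-fold join of the discrete space $G$ with the natural $G$-action. *)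

theory Defs
  imports "HOL-Algebra.Elementary_Groups" "HOL-Algebra.Group_Action" "HOL-Analysis.Analysis" "HOL-Homology.Simplices"
begin

section \<open>Groups given by generators and relations\<close>

text \<open>A letter \<open>(x, True)\<close> is the generator \<open>x\<close>, and \<open>(x, False)\<close> is its formal inverse.
  A relation \<open>u = v\<close> is given by the pair \<open>(u, v)\<close> of words.\<close>

type_synonym 'x word = "('x \<times> bool) list"

inductive presented_eq :: "('x word \<times> 'x word) set \<Rightarrow> 'x word \<Rightarrow> 'x word \<Rightarrow> bool"
  for R where
  pe_refl: "presented_eq R u u"
| pe_sym: "presented_eq R u v \<Longrightarrow> presented_eq R v u"
| pe_trans: "presented_eq R u v \<Longrightarrow> presented_eq R v w \<Longrightarrow> presented_eq R u w"
| pe_append: "presented_eq R u u' \<Longrightarrow> presented_eq R v v' \<Longrightarrow> presented_eq R (u @ v) (u' @ v')"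
| pe_cancel: "presented_eq R [(x, e), (x, \<not> e)] []"
| pe_relation: "(u, v) \<in> R \<Longrightarrow> presented_eq R u v"

definition presented_rel :: "('x word \<times> 'x word) set \<Rightarrow> ('x word \<times> 'x word) set" where
  "presented_rel R = {(u, v). presented_eq R u v}"

text \<open>The group \<open>\<langle>x \<in> UNIV :: 'x set | R\<rangle>\<close>, whose elements are the classes of words.\<close>

definition presented_group :: "('x word \<times> 'x word) set \<Rightarrow> 'x word set monoid" where
  "presented_group R =
     \<lparr>carrier = UNIV // presented_rel R,
      monoid.mult = (\<lambda>A B. \<Union>u\<in>A. \<Union>v\<in>B. presented_rel R `` {u @ v}),
      one = presented_rel R `` {[]}\<rparr>"

lemma equiv_presented_rel: "equiv UNIV (presented_rel R)"
  by (auto intro!: equivI refl_onI symI transI simp: presented_rel_def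
      intro: presented_eq.intros)

lemma presented_group_mult:
  "(presented_rel R `` {u}) \<otimes>\<^bsub>presented_group R\<^esub> (presented_rel R `` {v})
     = presented_rel R `` {u @ v}"
proof -
  have "presented_rel R `` {u @ v} = presented_rel R `` {u' @ v'}"
    if "(u, u') \<in> presented_rel R" "(v, v') \<in> presented_rel R" for u u' v v'
    using that by (intro equiv_class_eq[OF equiv_presented_rel])
      (auto simp: presented_rel_def intro: pe_append)
  then have "congruent2 (presented_rel R) (presented_rel R) (\<lambda>u v. presented_rel R `` {u @ v})"
    unfolding congruent2_def by (simp add: case_prod_beta del: Image_singleton_iff)
  then show ?thesis
    by (simp add: presented_group_def del: Image_singleton_iff
        add: UN_equiv_class2[OF equiv_presented_rel equiv_presented_rel])
qed

lemma presented_eq_inverse: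
  "presented_eq R (rev (map (\<lambda>(x, e). (x, \<not> e)) u) @ u) []"
proof (induction u)
  case (Cons l u)
  obtain x e where l: "l = (x, e)" by (cases l)
  let ?v = "rev (map (\<lambda>(x, e). (x, \<not> e)) u)"
  have "presented_eq R ([(x, \<not> e), (x, e)]) []"
    using pe_cancel[of R x "\<not> e"] by simp
  then have "presented_eq R (?v @ ([(x, \<not> e), (x, e)] @ u)) (?v @ ([] @ u))"
    by (intro pe_append pe_refl)
  with Cons show ?case by (auto simp: l intro: pe_trans)
qed (auto intro: pe_refl)

lemma group_presented_group: "group (presented_group R)"
proof (rule groupI)
  have carrier_eq: "carrier (presented_group R) = (\<lambda>u. presented_rel R `` {u}) ` UNIV"
    by (auto simp: presented_group_def quotient_def)
  have one_eq: "\<one>\<^bsub>presented_group R\<^esub> = presented_rel R `` {[]}"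
    by (simp add: presented_group_def)
  show "\<one>\<^bsub>presented_group R\<^esub> \<in> carrier (presented_group R)"
    by (auto simp: carrier_eq one_eq)
  fix A B C
  assume A: "A \<in> carrier (presented_group R)"
  show "\<one>\<^bsub>presented_group R\<^esub> \<otimes>\<^bsub>presented_group R\<^esub> A = A"
    using A by (auto simp: carrier_eq one_eq presented_group_mult simp del: Image_singleton_iff)
  show "\<exists>B\<in>carrier (presented_group R). B \<otimes>\<^bsub>presented_group R\<^esub> A = \<one>\<^bsub>presented_group R\<^esub>"
  proof -
    obtain u where u: "A = presented_rel R `` {u}" using A by (auto simp: carrier_eq)
    have "presented_rel R `` {rev (map (\<lambda>(x, e). (x, \<not> e)) u) @ u} = presented_rel R `` {[]}"
      by (rule equiv_class_eq[OF equiv_presented_rel])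
        (simp add: presented_rel_def presented_eq_inverse)
    then show ?thesis
      by (auto simp: carrier_eq one_eq u presented_group_mult simp del: Image_singleton_iff)
  qed
  assume B: "B \<in> carrier (presented_group R)"
  show "A \<otimes>\<^bsub>presented_group R\<^esub> B \<in> carrier (presented_group R)"
    using A B by (auto simp: carrier_eq presented_group_mult simp del: Image_singleton_iff)
  assume C: "C \<in> carrier (presented_group R)"
  show "A \<otimes>\<^bsub>presented_group R\<^esub> B \<otimes>\<^bsub>presented_group R\<^esub> C
      = A \<otimes>\<^bsub>presented_group R\<^esub> (B \<otimes>\<^bsub>presented_group R\<^esub> C)"
    using A B C by (auto simp: carrier_eq presented_group_mult simp del: Image_singleton_iff)
qed


section \<open>Nice groups\<close>

datatype quaternion_gen = QA | QB

text \<open>\<open>Q\<^bsub>4n\<^esub> = \<langle>a, b : a\<^sup>n = b\<^sup>2, a\<^bsup>2n\<^esup> = 1, b\<^sup>-\<^sup>1 a b = a\<^sup>-\<^sup>1\<rangle>\<close>\<close>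

definition quaternion_relations :: "nat \<Rightarrow> (quaternion_gen word \<times> quaternion_gen word) set" where
  "quaternion_relations n =
     {(replicate n (QA, True), replicate 2 (QB, True)),
      (replicate (2 * n) (QA, True), []),
      ([(QB, False), (QA, True), (QB, True)], [(QA, False)])}"

definition generalized_quaternion_group :: "nat \<Rightarrow> quaternion_gen word set monoid" where
  "generalized_quaternion_group n = presented_group (quaternion_relations n)"

definition nice_group :: "'g monoid \<Rightarrow> bool" where
  "nice_group G \<longleftrightarrow> group G \<and> finite (carrier G) \<and>
     (cyclic_group G \<and> (\<exists>p m. prime (p::nat) \<and> Coset.order G = p ^ m) \<or>
      (\<exists>n\<ge>2. G \<cong> generalized_quaternion_group n) \<and> (\<exists>m. Coset.order G = 2 ^ m))"


section \<open>The space \<open>E\<^sub>k G\<close>\<close>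

definition quotient_topology :: "'a topology \<Rightarrow> ('a \<times> 'a) set \<Rightarrow> 'a set topology" where
  "quotient_topology X r = topology (\<lambda>U. U \<subseteq> topspace X // r \<and> openin X (\<Union>U))"

lemma openin_quotient_topology:
  assumes "equiv (topspace X) r"
  shows "openin (quotient_topology X r) U \<longleftrightarrow> U \<subseteq> topspace X // r \<and> openin X (\<Union>U)"
proof -
  have int: "\<Union>(U \<inter> V) = \<Union>U \<inter> \<Union>V"
    if "U \<subseteq> topspace X // r" "V \<subseteq> topspace X // r" for U V
    using that quotient_disj[OF assms] by blast
  have un: "openin X (\<Union>(\<Union>\<U>))" if "\<forall>U\<in>\<U>. openin X (\<Union>U)" for \<U>
  proof -
    have "\<Union>(\<Union>\<U>) = \<Union>(Union ` \<U>)" by blast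
    then show ?thesis using that by (metis (no_types, lifting) image_iff openin_Union)
  qed
  have "istopology (\<lambda>U. U \<subseteq> topspace X // r \<and> openin X (\<Union>U))"
    unfolding istopology_def using un by (auto simp: int)
  then show ?thesis
    by (simp add: quotient_topology_def)
qed

text \<open>The \<open>(k+1)\<close>-fold join of a space \<open>X\<close> is the space of formal convex combinations
  \<open>t\<^sub>0 x\<^sub>0 + \<dots> + t\<^sub>k x\<^sub>k\<close>: the quotient of \<open>\<Delta>\<^sup>k \<times> X\<^bsup>k+1\<^esup>\<close> by the relation which forgets
  \<open>x\<^sub>i\<close> whenever \<open>t\<^sub>i = 0\<close>. For compact Hausdorff \<open>X\<close> (here: a finite discrete group)
  this agrees with the iterated two-fold join.\<close>

definition join_domain :: "nat \<Rightarrow> 'a topology \<Rightarrow> ((nat \<Rightarrow> real) \<times> (nat \<Rightarrow> 'a)) topology" where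
  "join_domain k X =
     prod_topology (subtopology (powertop_real UNIV) (standard_simplex k))
                   (product_topology (\<lambda>_. X) {..k})"

definition join_rel ::
  "nat \<Rightarrow> 'a topology \<Rightarrow> (((nat \<Rightarrow> real) \<times> (nat \<Rightarrow> 'a)) \<times> ((nat \<Rightarrow> real) \<times> (nat \<Rightarrow> 'a))) set" where
  "join_rel k X =
     {((t, x), (s, y)). (t, x) \<in> topspace (join_domain k X) \<and> (s, y) \<in> topspace (join_domain k X) \<and>
        t = s \<and> (\<forall>i\<le>k. t i \<noteq> 0 \<longrightarrow> x i = y i)}"

definition join_power :: "nat \<Rightarrow> 'a topology \<Rightarrow> ((nat \<Rightarrow> real) \<times> (nat \<Rightarrow> 'a)) set topology" where
  "join_power k X = quotient_topology (join_domain k X) (join_rel k X)"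

lemma equiv_join_rel: "equiv (topspace (join_domain k X)) (join_rel k X)"
  by (rule equivI) (auto simp: join_rel_def refl_on_def sym_def trans_def)

definition EG :: "'g monoid \<Rightarrow> nat \<Rightarrow> ((nat \<Rightarrow> real) \<times> (nat \<Rightarrow> 'g)) set topology" where
  "EG G k = join_power k (discrete_topology (carrier G))"

text \<open>\<open>g \<cdot> (t\<^sub>0 x\<^sub>0 + \<dots> + t\<^sub>k x\<^sub>k) = t\<^sub>0 (g x\<^sub>0) + \<dots> + t\<^sub>k (g x\<^sub>k)\<close>\<close>

definition EG_action ::
  "'g monoid \<Rightarrow> nat \<Rightarrow> 'g \<Rightarrow> ((nat \<Rightarrow> real) \<times> (nat \<Rightarrow> 'g)) set \<Rightarrow> ((nat \<Rightarrow> real) \<times> (nat \<Rightarrow> 'g)) set"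
  where
  "EG_action G k g c = (\<lambda>(t, x). (t, \<lambda>i\<in>{..k}. g \<otimes>\<^bsub>G\<^esub> x i)) ` c"


section \<open>The mapping index\<close>

definition equivariant_map ::
  "'g monoid \<Rightarrow> 'a topology \<Rightarrow> ('g \<Rightarrow> 'a \<Rightarrow> 'a) \<Rightarrow> 'b topology \<Rightarrow> ('g \<Rightarrow> 'b \<Rightarrow> 'b) \<Rightarrow> ('a \<Rightarrow> 'b) \<Rightarrow> bool"
  where
  "equivariant_map G X \<phi> Y \<psi> f \<longleftrightarrow>
     continuous_map X Y f \<and> (\<forall>g\<in>carrier G. \<forall>x\<in>topspace X. f (\<phi> g x) = \<psi> g (f x))"

text \<open>The infimum in \<^typ>\<open>enat\<close> is the minimum if some \<open>k\<close> is admissible, and \<open>\<infinity>\<close> otherwise.\<close>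

definition mapping_index :: "'g monoid \<Rightarrow> 'a topology \<Rightarrow> ('g \<Rightarrow> 'a \<Rightarrow> 'a) \<Rightarrow> enat" where
  "mapping_index G X \<phi> =
     Inf {enat k | k. \<exists>f. equivariant_map G X \<phi> (EG G k) (EG_action G k) f}"


section \<open>Finite free \<open>G\<close>-simplicial complexes\<close>

text \<open>A complex is a finite geometric simplicial complex \<open>K\<close> in some Euclidean space (finiteness
  is part of \<^const>\<open>simplicial_complex\<close>), with underlying space \<open>\<Union>K\<close>. An action is simplicial
  if every group element carries each simplex affinely onto a simplex. Freeness refers to all
  points of the underlying space, not only to the vertices.\<close>

definition free_simplicial_complex ::
  "'g monoid \<Rightarrow> 'a::euclidean_space set set \<Rightarrow> ('g \<Rightarrow> 'a \<Rightarrow> 'a) \<Rightarrow> bool" where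
  "free_simplicial_complex G K \<phi> \<longleftrightarrow>
     simplicial_complex K \<and>
     group_action G (\<Union>K) \<phi> \<and>
     (\<forall>g\<in>carrier G. \<forall>S\<in>K. \<phi> g ` S \<in> K \<and>
        (\<forall>x\<in>S. \<forall>y\<in>S. \<forall>u\<in>{0..1}.
           \<phi> g ((1 - u) *\<^sub>R x + u *\<^sub>R y) = (1 - u) *\<^sub>R \<phi> g x + u *\<^sub>R \<phi> g y)) \<and>
     (\<forall>g\<in>carrier G. g \<noteq> \<one>\<^bsub>G\<^esub> \<longrightarrow> (\<forall>x\<in>\<Union>K. \<phi> g x \<noteq> x))"

definition diagonal_action ::
  "('g \<Rightarrow> 'a \<Rightarrow> 'a) \<Rightarrow> ('g \<Rightarrow> 'b \<Rightarrow> 'b) \<Rightarrow> 'g \<Rightarrow> 'a \<times> 'b \<Rightarrow> 'a \<times> 'b" where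
  "diagonal_action \<phi> \<psi> g = (\<lambda>(x, y). (\<phi> g x, \<psi> g y))"

end

theory Submission
  imports Defs "HOL-Algebra.Multiplicative_Group" "HOL-Number_Theory.Cong"
begin

text \<open>Since \<open>E\<^sub>0 G = G\<close> is discrete, a complex has index \<open>0\<close> iff no nontrivial element of \<open>G\<close> maps
  a connected component to itself. So both \<open>\<K>\<^sub>1\<close> and \<open>\<K>\<^sub>2\<close> have a component with nontrivial
  stabilizer. A nice group has a smallest nontrivial subgroup, which lies in both stabilizers;
  hence it stabilizes the connected product of the two components, and the product has no
  equivariant map to \<open>E\<^sub>0 G\<close>. A map to \<open>E\<^sub>1 G\<close> is obtained from the projection to \<open>\<K>\<^sub>1\<close>.\<close>

section \<open>Nice groups\<close>

text \<open>Since \<open>u [^] i\<close> is nontrivial, the gcd of \<open>i\<close> and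
  \<open>p ^ m\<close> is a proper divisor of \<open>p ^ m\<close>. It therefore divides
  \<open>p ^ (m - 1)\<close>, and a linear congruence yields \<open>k\<close>. The hypothesis on
  \<open>i\<close> also forces \<open>m > 0\<close>, so \<open>m - 1\<close> is not
  truncated.\<close>

lemma (in group) pow_of_prime_power_order:
  fixes i :: nat
  assumes u: "u \<in> carrier G" and p: "prime (p::nat)" "ord u = p ^ m" and i: "u [^] i \<noteq> \<one>"
  shows "\<exists>k::nat. (u [^] i) [^] k = u [^] (p ^ (m - 1))" and "u [^] (p ^ (m - 1)) \<noteq> \<one>"
proof -
  have ndvd: "\<not> p ^ m dvd i"
    using pow_eq_id[OF u, of i] i p by simp
  obtain j where j: "j \<le> m" "gcd i (p ^ m) = p ^ j"
    using divides_primepow_nat[OF p(1), of "gcd i (p ^ m)" m] by auto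
  have "j \<noteq> m"
    using ndvd j(2) by (metis gcd_dvd1)
  then have "gcd i (p ^ m) dvd p ^ (m - 1)"
    using j by (simp add: le_imp_power_dvd)
  then obtain k where "[i * k = p ^ (m - 1)] (mod p ^ m)"
    using cong_solve_dvd_nat by blast
  then have "int (ord u) dvd int (i * k) - int (p ^ (m - 1))"
    using p(2) by (metis cong_iff_dvd_diff cong_int_iff)
  then have "u [^] int (i * k) = u [^] int (p ^ (m - 1))"
    using int_pow_eq[OF u] by (simp add: dvd_diff_commute)
  then show "\<exists>k::nat. (u [^] i) [^] k = u [^] (p ^ (m - 1))"
    using u by (metis int_pow_int nat_pow_pow)
  have "p ^ (m - 1) < p ^ m"
    using prime_gt_1_nat[OF p(1)] j(1) \<open>j \<noteq> m\<close> by (intro power_strict_increasing) simp_all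
  then have "\<not> p ^ m dvd p ^ (m - 1)"
    using p(1) by (simp add: nat_dvd_not_less prime_gt_0_nat)
  then show "u [^] (p ^ (m - 1)) \<noteq> \<one>"
    using pow_eq_id[OF u] p(2) by metis
qed

section \<open>Normal forms in generalized quaternion groups\<close>

text \<open>The relations are imposed on two elements of an arbitrary group, so that the
  computations use group arithmetic instead of classes of words. A collapse such as
  \<open>a [^] n = \<one>\<close> is still possible here; it is excluded later by the action on
  pairs of complex numbers.\<close>

locale quaternion_pair = group +
  fixes a b :: 'a and n :: nat
  assumes a: "a \<in> carrier G" and b: "b \<in> carrier G"
    and n: "n > 0"
    and pow_n: "a [^] n = b [^] (2::nat)"
    and pow_2n: "a [^] (2 * n) = \<one>"
    and conj: "inv b \<otimes> a \<otimes> b = inv a"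
begin

text \<open>Inverse-free form of the rule that \<open>b\<close> inverts powers of \<open>a\<close>:
  \<open>conj\<close> gives \<open>a \<otimes> b \<otimes> a = b\<close>, and this can be iterated
  from the inside.\<close>

lemma pow_b_pow: "a [^] (i::nat) \<otimes> b \<otimes> a [^] i = b"
proof (induction i)
  case (Suc i)
  have "a \<otimes> b = b \<otimes> inv a"
    using conj a b by (metis inv_closed inv_solve_left m_assoc m_closed)
  then have "a \<otimes> b \<otimes> a = b"
    using a b by (simp add: m_assoc)
  moreover have "a [^] Suc i \<otimes> b \<otimes> a [^] Suc i = (a [^] i \<otimes> a) \<otimes> b \<otimes> (a \<otimes> a [^] i)"
    using nat_pow_Suc2[OF a, of i] by simp
  moreover have "\<dots> = a [^] i \<otimes> (a \<otimes> b \<otimes> a) \<otimes> a [^] i"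
    using a b by (simp add: m_assoc)
  ultimately show ?case
    using Suc by simp
qed (use b in simp)

text \<open>As \<open>a [^] (2 * n) = \<one>\<close>, the factor \<open>2 * n - 1\<close> in the
  exponent acts as -1, which keeps all exponents natural.\<close>

lemma b_pow: "b \<otimes> a [^] (i::nat) = a [^] ((2 * n - 1) * i) \<otimes> b"
proof -
  have "(2 * n - 1) * i + i = 2 * n * i"
    using n by (cases n) (auto simp: algebra_simps)
  then have *: "a [^] ((2 * n - 1) * i) \<otimes> a [^] i = \<one>"
    using a pow_2n by (metis nat_pow_mult nat_pow_one nat_pow_pow)
  have "a [^] ((2 * n - 1) * i) \<otimes> b = a [^] ((2 * n - 1) * i) \<otimes> (a [^] i \<otimes> b \<otimes> a [^] i)"
    by (simp add: pow_b_pow)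
  also have "\<dots> = (a [^] ((2 * n - 1) * i) \<otimes> a [^] i) \<otimes> b \<otimes> a [^] i"
    using a b by (simp add: m_assoc)
  finally show ?thesis
    using * a b by simp
qed

text \<open>Exponents are left unbounded, so closure under multiplication requires no reduction
  modulo \<open>2 * n\<close>.\<close>

definition normal_forms :: "'a set" where
  "normal_forms = range (\<lambda>i::nat. a [^] i) \<union> range (\<lambda>i::nat. a [^] i \<otimes> b)"

lemma normal_forms_mult_a:
  assumes "g \<in> normal_forms" shows "a \<otimes> g \<in> normal_forms"
proof -
  have "a \<otimes> a [^] i = a [^] Suc i" "a \<otimes> (a [^] i \<otimes> b) = a [^] Suc i \<otimes> b" for i :: nat
    using a b nat_pow_Suc2[OF a, of i] by (simp_all add: m_assoc[symmetric] del: nat_pow_Suc)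
  then show ?thesis
    using assms unfolding normal_forms_def by blast
qed

lemma normal_forms_mult_b:
  assumes "g \<in> normal_forms" shows "b \<otimes> g \<in> normal_forms"
proof -
  have "b \<otimes> (a [^] i \<otimes> b) = a [^] ((2 * n - 1) * i + n)" for i :: nat
  proof -
    have "b \<otimes> (a [^] i \<otimes> b) = a [^] ((2 * n - 1) * i) \<otimes> b \<otimes> b"
      using a b by (simp add: b_pow flip: m_assoc)
    also have "\<dots> = a [^] ((2 * n - 1) * i) \<otimes> a [^] n"
      using a b by (simp add: pow_n numeral_2_eq_2 m_assoc)
    finally show ?thesis
      using a by (simp add: nat_pow_mult)
  qed
  then show ?thesis
    using assms b_pow unfolding normal_forms_def by blast
qed

text \<open>Both generators have finite order, so their inverses are the natural powers
  \<open>a [^] (2 * n - 1)\<close> and \<open>b [^] 3\<close>; repeated left multiplication by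
  \<open>a\<close> or \<open>b\<close> then suffices.\<close>

lemma normal_forms_mult_inv:
  assumes g: "g \<in> normal_forms"
  shows "inv a \<otimes> g \<in> normal_forms" "inv b \<otimes> g \<in> normal_forms"
proof -
  have pow: "x [^] (k::nat) \<otimes> g \<in> normal_forms"
    if "x \<in> carrier G" "\<And>h. h \<in> normal_forms \<Longrightarrow> x \<otimes> h \<in> normal_forms" for x k
  proof (induction k)
    case (Suc k)
    have "g \<in> carrier G"
      using g a b by (auto simp: normal_forms_def)
    then show ?case
      using that Suc nat_pow_Suc2[OF that(1), of k] by (simp add: m_assoc del: nat_pow_Suc)
  qed (use g a b in \<open>auto simp: normal_forms_def\<close>)
  have inv_eq: "inv x = x [^] (k - 1)" if "x \<in> carrier G" "x [^] k = \<one>" "k > 0" for x and k :: nat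
    using that by (intro inv_equality) (auto simp: nat_pow_Suc[symmetric] simp del: nat_pow_Suc)
  have b4: "b [^] (4::nat) = \<one>"
  proof -
    have "b [^] (2 * 2 ::nat) = \<one>"
      using pow_2n pow_n a b by (metis mult.commute nat_pow_pow)
    then show ?thesis by simp
  qed
  show "inv a \<otimes> g \<in> normal_forms"
    using pow[OF a normal_forms_mult_a] inv_eq[OF a pow_2n] n by simp
  show "inv b \<otimes> g \<in> normal_forms"
    using pow[OF b normal_forms_mult_b] inv_eq[OF b b4] by simp
qed

text \<open>An element \<open>a [^] i \<otimes> b\<close> squares to \<open>a [^] n\<close>. A
  nontrivial power of \<open>a\<close> has the generator \<open>?w\<close> of the smallest subgroup
  of the cyclic 2-group of \<open>a\<close> among its powers, and \<open>?w\<close> turns out to be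
  \<open>a [^] n\<close>.\<close>

lemma normal_forms_pow:
  assumes g: "g \<in> normal_forms" "g \<noteq> \<one>" and ne: "a [^] n \<noteq> \<one>" and ord: "ord a = 2 ^ m"
  shows "\<exists>k::nat. g [^] k = a [^] n"
proof -
  have sq: "(a [^] i \<otimes> b) [^] (2::nat) = a [^] n" for i :: nat
  proof -
    have "(a [^] i \<otimes> b) [^] (2::nat) = (a [^] i \<otimes> b \<otimes> a [^] i) \<otimes> b"
      using a b by (simp add: numeral_2_eq_2 m_assoc)
    also have "\<dots> = a [^] n"
      using a b by (simp only: pow_b_pow pow_n) (simp add: numeral_2_eq_2)
    finally show ?thesis .
  qed
  let ?w = "a [^] ((2::nat) ^ (m - 1))"
  obtain k :: nat where k: "(a [^] n) [^] k = ?w" and w: "?w \<noteq> \<one>"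
    using pow_of_prime_power_order[OF a two_is_prime_nat ord ne] by blast
  \<comment> \<open>The square of \<open>a [^] n\<close> is trivial, so only the parity of
    \<open>k\<close> matters; \<open>k\<close> is odd because \<open>?w\<close> is
    nontrivial.\<close>
  have "(a [^] n) [^] (2 * (k div 2)) = (a [^] (2 * n)) [^] (k div 2)"
    using a by (simp add: nat_pow_pow mult.assoc mult.left_commute)
  then have even: "(a [^] n) [^] (2 * (k div 2)) = \<one>"
    using pow_2n by simp
  have "(a [^] n) [^] k = (a [^] n) [^] (2 * (k div 2)) \<otimes> (a [^] n) [^] (k mod 2)"
    using a by (simp only: nat_pow_mult nat_pow_closed mult_div_mod_eq)
  then have k2: "?w = (a [^] n) [^] (k mod 2)"
    using a unfolding even k by simp
  then have "k mod 2 \<noteq> 0"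
    using w by (metis nat_pow_0)
  then have "?w = a [^] n"
    unfolding k2 not_mod_2_eq_0_eq_1 using a by simp
  moreover have "\<exists>k::nat. g [^] k = ?w" if "g = a [^] (i::nat)" for i
    using pow_of_prime_power_order(1)[OF a two_is_prime_nat ord, of i] that g by blast
  moreover obtain i :: nat where "g = a [^] i \<or> g = a [^] i \<otimes> b"
    using g(1) unfolding normal_forms_def by blast
  ultimately show ?thesis
    using sq[of i] by metis
qed

end

text \<open>The action of \<open>Q\<^bsub>4n\<^esub>\<close> on \<open>\<complex>\<^sup>2\<close> by \<open>a \<mapsto> diag(\<zeta>, \<zeta>\<^sup>-\<^sup>1)\<close>, \<open>\<zeta> = exp(i\<pi>/n)\<close>, shows
  that \<open>a\<^sup>n \<noteq> 1\<close>.\<close>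

fun quaternion_letter :: "nat \<Rightarrow> quaternion_gen \<times> bool \<Rightarrow> complex \<times> complex \<Rightarrow> complex \<times> complex" where
  "quaternion_letter n (QA, True) (x, y) = (cis (pi / n) * x, cnj (cis (pi / n)) * y)"
| "quaternion_letter n (QA, False) (x, y) = (cnj (cis (pi / n)) * x, cis (pi / n) * y)"
| "quaternion_letter n (QB, True) (x, y) = (- y, x)"
| "quaternion_letter n (QB, False) (x, y) = (y, - x)"

text \<open>With \<open>foldr\<close> the first letter acts last, so concatenation of words becomes
  composition of maps.\<close>

definition quaternion_word :: "nat \<Rightarrow> quaternion_gen word \<Rightarrow> complex \<times> complex \<Rightarrow> complex \<times> complex" where
  "quaternion_word n u = foldr (quaternion_letter n) u"

lemma quaternion_word_replicate:
  "quaternion_word n (replicate k (QA, True)) (x, y)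
     = (cis (pi / n) ^ k * x, cnj (cis (pi / n)) ^ k * y)"
  by (induction k) (auto simp: quaternion_word_def)

lemma cis_pi_div_pow:
  assumes "n > 0" shows "cis (pi / n) ^ n = -1"
proof -
  have "real n * (pi / real n) = pi"
    using assms by simp
  then show ?thesis
    by (simp only: Complex.DeMoivre cis_pi)
qed

text \<open>This makes the action well defined on the presented group. On the relations: the
  \<open>n\<close>-th power of \<open>QA\<close> and the square of \<open>QB\<close> both act as -1,
  and conjugation by \<open>QB\<close> exchanges the two eigenvalues of \<open>QA\<close>.\<close>

lemma quaternion_word_cong:
  assumes "presented_eq (quaternion_relations n) u v" and n: "n > 0"
  shows "quaternion_word n u = quaternion_word n v"
  using assms(1)
proof (induction rule: presented_eq.induct)
  case (pe_cancel x e)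
  have "cis (pi / n) * (cnj (cis (pi / n)) * z) = z" "cnj (cis (pi / n)) * (cis (pi / n) * z) = z" for z
    by (simp_all add: cis_cnj cis_mult flip: mult.assoc)
  then show ?case
    by (cases x; cases e) (auto simp: quaternion_word_def fun_eq_iff)
next
  case (pe_relation u v)
  have c: "cis (pi / n) ^ n = -1" "cnj (cis (pi / n)) ^ n = -1"
    using cis_pi_div_pow[OF n] by (simp_all flip: complex_cnj_power)
  then have "quaternion_word n (replicate (2 * n) (QA, True)) = quaternion_word n []"
    by (auto simp: quaternion_word_replicate power_mult power2_eq_square mult.commute[of 2] fun_eq_iff)
      (simp_all add: quaternion_word_def)
  moreover have "quaternion_word n (replicate n (QA, True)) = quaternion_word n (replicate 2 (QB, True))"
    using c by (auto simp: quaternion_word_replicate fun_eq_iff)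
      (simp_all add: quaternion_word_def numeral_2_eq_2)
  moreover have "quaternion_word n [(QB, False), (QA, True), (QB, True)] = quaternion_word n [(QA, False)]"
    by (auto simp: quaternion_word_def fun_eq_iff)
  ultimately show ?case
    using pe_relation by (auto simp: quaternion_relations_def)
qed (auto simp: quaternion_word_def)

section \<open>The smallest nontrivial subgroup of a nice group\<close>

text \<open>The witness is the \<open>n\<close>-th power of the class of \<open>QA\<close>. The
  hypothesis on the group order enters through Lagrange: it makes the order of that class a power of
  2.\<close>

lemma generalized_quaternion_pow:
  fixes n :: nat
  defines "Q \<equiv> generalized_quaternion_group n"
  assumes n: "n > 0" and order: "Coset.order Q = 2 ^ m"
  shows "\<exists>z\<in>carrier Q. z \<noteq> \<one>\<^bsub>Q\<^esub> \<and> (\<forall>g\<in>carrier Q. g \<noteq> \<one>\<^bsub>Q\<^esub> \<longrightarrow> (\<exists>k::nat. g [^]\<^bsub>Q\<^esub> k = z))"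
proof -
  define cl where "cl u = presented_rel (quaternion_relations n) `` {u}" for u
  interpret Q: group Q
    unfolding Q_def generalized_quaternion_group_def by (rule group_presented_group)
  have cl_eq: "cl u = cl v \<longleftrightarrow> presented_eq (quaternion_relations n) u v" for u v
    unfolding cl_def using eq_equiv_class_iff[OF equiv_presented_rel, of u v]
    by (simp add: presented_rel_def)
  have mult: "cl u \<otimes>\<^bsub>Q\<^esub> cl v = cl (u @ v)" for u v
    unfolding Q_def generalized_quaternion_group_def cl_def by (rule presented_group_mult)
  have one: "\<one>\<^bsub>Q\<^esub> = cl []"
    by (simp add: Q_def generalized_quaternion_group_def cl_def presented_group_def)
  have carrier: "carrier Q = range cl"
    by (auto simp: Q_def generalized_quaternion_group_def cl_def presented_group_def quotient_def)
  have pow: "cl [l] [^]\<^bsub>Q\<^esub> (k::nat) = cl (replicate k l)" for l k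
    by (induction k) (auto simp: one mult simp flip: replicate_append_same)
  have rel: "cl u = cl v" if "(u, v) \<in> quaternion_relations n" for u v
    using that by (simp add: cl_eq pe_relation)
  have inv: "cl [(x, False)] = inv\<^bsub>Q\<^esub> cl [(x, True)]" for x
    using pe_cancel[of "quaternion_relations n" x False]
    by (intro Q.inv_equality[symmetric]) (auto simp: carrier mult one cl_eq)
  interpret Q: quaternion_pair Q "cl [(QA, True)]" "cl [(QB, True)]" n
  proof
    show "cl [(QA, True)] [^]\<^bsub>Q\<^esub> n = cl [(QB, True)] [^]\<^bsub>Q\<^esub> (2::nat)"
      unfolding pow by (rule rel) (simp add: quaternion_relations_def)
    show "cl [(QA, True)] [^]\<^bsub>Q\<^esub> (2 * n) = \<one>\<^bsub>Q\<^esub>"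
      unfolding pow one by (rule rel) (simp add: quaternion_relations_def)
    show "inv\<^bsub>Q\<^esub> cl [(QB, True)] \<otimes>\<^bsub>Q\<^esub> cl [(QA, True)] \<otimes>\<^bsub>Q\<^esub> cl [(QB, True)] = inv\<^bsub>Q\<^esub> cl [(QA, True)]"
      unfolding inv[symmetric] mult by (rule rel) (simp add: quaternion_relations_def)
  qed (use n in \<open>auto simp: carrier\<close>)
  have normal_forms: "cl u \<in> Q.normal_forms" for u
  proof (induction u)
    case Nil
    have "cl [] = cl [(QA, True)] [^]\<^bsub>Q\<^esub> (0::nat)"
      by (simp add: one)
    then show ?case
      unfolding Q.normal_forms_def by blast
  next
    case (Cons l u)
    obtain x e where l: "l = (x, e)" by (cases l)
    have "cl (l # u) = cl [l] \<otimes>\<^bsub>Q\<^esub> cl u"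
      by (simp add: mult)
    with Cons l show ?case
      by (cases x; cases e)
        (simp_all add: inv Q.normal_forms_mult_a Q.normal_forms_mult_b Q.normal_forms_mult_inv)
  qed
  \<comment> \<open>The corresponding word sends (1, 0) to (-1, 0), whereas the empty word fixes
    it.\<close>
  have ne: "cl [(QA, True)] [^]\<^bsub>Q\<^esub> n \<noteq> \<one>\<^bsub>Q\<^esub>"
  proof
    assume "cl [(QA, True)] [^]\<^bsub>Q\<^esub> n = \<one>\<^bsub>Q\<^esub>"
    then have "quaternion_word n (replicate n (QA, True)) (1, 0) = quaternion_word n [] (1, 0)"
      using quaternion_word_cong[OF _ n] by (metis cl_eq one pow)
    then show False
      using cis_pi_div_pow[OF n] by (simp add: quaternion_word_replicate) (simp add: quaternion_word_def)
  qed
  obtain m' where m': "Q.ord (cl [(QA, True)]) = 2 ^ m'"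
    using Q.ord_dvd_group_order[of "cl [(QA, True)]"] order
      divides_primepow_nat[OF two_is_prime_nat] carrier by auto
  have "\<exists>k::nat. g [^]\<^bsub>Q\<^esub> k = cl [(QA, True)] [^]\<^bsub>Q\<^esub> n"
    if g: "g \<in> carrier Q" "g \<noteq> \<one>\<^bsub>Q\<^esub>" for g
  proof -
    have "g \<in> Q.normal_forms"
      using g(1) normal_forms unfolding carrier by (elim rangeE) (simp only:)
    then show ?thesis
      by (rule Q.normal_forms_pow[OF _ g(2) ne m'])
  qed
  moreover have "cl [(QA, True)] [^]\<^bsub>Q\<^esub> n \<in> carrier Q"
    using Q.a by simp
  ultimately show ?thesis
    using ne by blast
qed

text \<open>A nice group has a smallest nontrivial subgroup; \<open>z\<close> generates it.\<close>

lemma nice_group_minimal_power: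
  fixes G (structure)
  assumes nice: "nice_group G" and g: "g \<in> carrier G" "g \<noteq> \<one>\<^bsub>G\<^esub>"
  obtains z where "z \<noteq> \<one>\<^bsub>G\<^esub>"
    "\<And>h. h \<in> carrier G \<Longrightarrow> h \<noteq> \<one>\<^bsub>G\<^esub> \<Longrightarrow> \<exists>k::nat. h [^]\<^bsub>G\<^esub> k = z"
proof -
  interpret group G
    using nice by (simp add: nice_group_def)
  consider p m where "cyclic_group G" "prime (p::nat)" "Coset.order G = p ^ m"
    | n m where "n \<ge> 2" "G \<cong> generalized_quaternion_group n" "Coset.order G = 2 ^ m"
    using nice unfolding nice_group_def by blast
  then show thesis
  proof cases
    case 1
    obtain u where u: "u \<in> carrier G" "carrier G = range (\<lambda>n::int. u [^] n)"
      using 1(1) cyclic_group by blast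
    obtain m where m: "ord u = p ^ m"
      using ord_dvd_group_order[OF u(1)] 1 divides_primepow_nat by metis
    \<comment> \<open>Integer exponents are reduced modulo \<open>ord u\<close>, as
      \<open>pow_of_prime_power_order\<close> takes natural ones.\<close>
    have nat_pow: "\<exists>i::nat. h = u [^] i" if h: "h \<in> carrier G" for h
    proof -
      obtain j :: int where j: "h = u [^] j"
        using h unfolding u(2) by blast
      have "ord u > 0"
        using m 1(2) by (simp add: prime_gt_0_nat)
      then have "int (nat (j mod int (ord u))) = j mod int (ord u)"
        by simp
      moreover have "u [^] (j mod int (ord u)) = u [^] j"
        using int_pow_eq[OF u(1)] by (metis mod_eq_dvd_iff mod_mod_trivial)
      ultimately show ?thesis
        using j by (metis int_pow_int)
    qed
    show thesis
    proof (rule that)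
      \<comment> \<open>The given \<open>g\<close> excludes the trivial group, in which the proposed
        generator would be \<open>\<one>\<close>.\<close>
      obtain i :: nat where "g = u [^] i"
        using nat_pow[OF g(1)] by blast
      then show "u [^] (p ^ (m - 1)) \<noteq> \<one>"
        using pow_of_prime_power_order(2)[OF u(1) 1(2) m] g(2) by blast
      fix h assume h: "h \<in> carrier G" "h \<noteq> \<one>"
      obtain j :: nat where "h = u [^] j"
        using nat_pow[OF h(1)] by blast
      then show "\<exists>k::nat. h [^] k = u [^] (p ^ (m - 1))"
        using pow_of_prime_power_order(1)[OF u(1) 1(2) m] h(2) by blast
    qed
  next
    case 2
    \<comment> \<open>The generator found in the presented group is carried over to \<open>G\<close>
      by an isomorphism.\<close>
    define Q where "Q = generalized_quaternion_group n"
    have Q: "group Q"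
      unfolding Q_def generalized_quaternion_group_def by (rule group_presented_group)
    obtain f where f: "f \<in> iso Q G"
      using 2(2) iso_sym unfolding Q_def is_iso_def by blast
    interpret f: group_hom Q G f
      using f by (intro group_hom.intro[OF Q is_group] group_hom_axioms.intro) (simp add: iso_def)
    have bij: "bij_betw f (carrier Q) (carrier G)"
      using f by (simp add: iso_def)
    have "Coset.order Q = 2 ^ m"
      using bij_betw_same_card[OF bij] 2(3) by (simp add: Coset.order_def)
    then obtain z where z: "z \<in> carrier Q" "z \<noteq> \<one>\<^bsub>Q\<^esub>"
      "\<And>h. h \<in> carrier Q \<Longrightarrow> h \<noteq> \<one>\<^bsub>Q\<^esub> \<Longrightarrow> \<exists>k::nat. h [^]\<^bsub>Q\<^esub> k = z"
      using generalized_quaternion_pow[of n m] 2(1) unfolding Q_def by auto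
    show thesis
    proof (rule that)
      show "f z \<noteq> \<one>"
        using inj_on_eq_iff[OF bij_betw_imp_inj_on[OF bij] z(1), of "\<one>\<^bsub>Q\<^esub>"] z(2) f.hom_one
          monoid.one_closed[OF group.is_monoid[OF Q]] by simp
      fix h assume h: "h \<in> carrier G" "h \<noteq> \<one>"
      then obtain h' where h': "h' \<in> carrier Q" "h = f h'"
        using bij by (metis bij_betw_imp_surj_on imageE)
      then obtain k :: nat where "h' [^]\<^bsub>Q\<^esub> k = z"
        using z(3)[of h'] h f.hom_one by metis
      then show "\<exists>k::nat. h [^] k = f z"
        using h' f.hom_nat_pow by metis
    qed
  qed
qed


section \<open>Mapping index\<close>

text \<open>The vertices \<open>1\<cdot>g\<close> of \<open>E\<^sub>0 G\<close>.\<close>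

definition EG0_point :: "'g \<Rightarrow> ((nat \<Rightarrow> real) \<times> (nat \<Rightarrow> 'g)) set" where
  "EG0_point g = {(\<lambda>j. if j = 0 then 1 else 0, \<lambda>i\<in>{..0}. g)}"

lemma EG0_point_inject: "EG0_point g = EG0_point h \<longleftrightarrow> g = h"
  by (auto simp: EG0_point_def dest: fun_cong[of _ _ "0::nat"])

lemma EG_action_EG0_point: "EG_action G 0 g (EG0_point h) = EG0_point (g \<otimes>\<^bsub>G\<^esub> h)"
  by (auto simp: EG_action_def EG0_point_def)

text \<open>The standard 0-simplex is one point with nonzero coordinate, so the join relation
  identifies nothing: its classes are the singletons \<open>EG0_point g\<close>. Each is open since
  \<open>G\<close> is discrete.\<close>

lemma EG_0:
  fixes G :: "'g monoid"
  shows "EG G 0 = discrete_topology (EG0_point ` carrier G)"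
proof -
  let ?X = "discrete_topology (carrier G)"
  let ?t = "\<lambda>j::nat. if j = 0 then 1 else (0::real)"
  have PiE: "(\<Pi>\<^sub>E i\<in>{..0::nat}. U) = (\<lambda>g. \<lambda>i\<in>{..0}. g) ` U" for U :: "'g set"
    unfolding atMost_0 PiE_over_singleton_iff by blast
  have "topspace (join_domain 0 ?X) = {?t} \<times> (\<Pi>\<^sub>E i\<in>{..0}. carrier G)"
    by (simp add: join_domain_def standard_simplex_0)
  then have topspace: "topspace (join_domain 0 ?X) = (\<lambda>g. (?t, \<lambda>i\<in>{..0}. g)) ` carrier G"
    unfolding PiE by blast
  have fibre: "join_rel 0 ?X `` {(?t, \<lambda>i\<in>{..0}. g)} = EG0_point g" if "g \<in> carrier G" for g
    using that unfolding join_rel_def topspace EG0_point_def by (auto 0 3 dest: fun_cong)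
  have "topspace (join_domain 0 ?X) // join_rel 0 ?X
      = (\<lambda>g. join_rel 0 ?X `` {(?t, \<lambda>i\<in>{..0}. g)}) ` carrier G"
    unfolding quotient_def topspace by blast
  also have "\<dots> = EG0_point ` carrier G"
    by (intro image_cong refl fibre)
  finally have quotient: "topspace (join_domain 0 ?X) // join_rel 0 ?X = EG0_point ` carrier G" .
  have openin: "openin (join_domain 0 ?X) (EG0_point g)" if "g \<in> carrier G" for g
  proof -
    have "openin (product_topology (\<lambda>_. ?X) {..0::nat}) (\<Pi>\<^sub>E i\<in>{..0}. {g})"
      using that by (subst openin_PiE_gen) auto
    moreover have "openin (subtopology (powertop_real UNIV) (standard_simplex 0)) {?t}"
      using openin_topspace[of "subtopology (powertop_real UNIV) (standard_simplex 0)"]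
      by (simp add: standard_simplex_0)
    ultimately have "openin (join_domain 0 ?X) ({?t} \<times> (\<Pi>\<^sub>E i\<in>{..0}. {g}))"
      unfolding join_domain_def openin_prod_Times_iff by blast
    moreover have "{?t} \<times> (\<Pi>\<^sub>E i\<in>{..0}. {g}) = EG0_point g"
      unfolding PiE EG0_point_def by simp
    ultimately show ?thesis by simp
  qed
  have "openin (EG G 0) S \<longleftrightarrow> S \<subseteq> EG0_point ` carrier G" for S
  proof -
    have "openin (join_domain 0 ?X) (\<Union>S)" if "S \<subseteq> EG0_point ` carrier G"
      using that openin by (intro openin_Union) auto
    then show ?thesis
      unfolding EG_def join_power_def openin_quotient_topology[OF equiv_join_rel] quotient by blast
  qed
  then show ?thesis
    by (simp add: topology_eq)
qed

text \<open>The infimum of the empty set is infinite, hence not 1, and a nonempty set in the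
  well-ordered type \<open>enat\<close> contains its infimum.\<close>

lemma mapping_index_eq_1_iff:
  "mapping_index G X \<phi> = 1 \<longleftrightarrow>
     (\<exists>f. equivariant_map G X \<phi> (EG G 1) (EG_action G 1) f) \<and>
     \<not> (\<exists>f. equivariant_map G X \<phi> (EG G 0) (EG_action G 0) f)"
proof -
  define P where "P k \<longleftrightarrow> (\<exists>f. equivariant_map G X \<phi> (EG G k) (EG_action G k) f)" for k
  have Inf: "mapping_index G X \<phi> = Inf {enat k | k. P k}"
    unfolding mapping_index_def P_def by (rule refl)
  have "mapping_index G X \<phi> = 1 \<longleftrightarrow> P 1 \<and> \<not> P 0"
  proof
    assume ind: "mapping_index G X \<phi> = 1"
    have "{enat k | k. P k} \<noteq> {}"
      using ind unfolding Inf by (metis Inf_empty infinity_ne_i1 top_enat_def)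
    then have "1 \<in> {enat k | k. P k}"
      using wellorder_InfI[of _ "{enat k | k. P k}"] ind
      unfolding Inf by (metis (no_types, lifting) ex_in_conv)
    moreover have "\<not> P 0"
    proof
      assume "P 0"
      then have "Inf {enat k | k. P k} \<le> enat 0"
        by (intro Inf_lower) blast
      then show False
        using ind unfolding Inf by (simp add: zero_enat_def[symmetric])
    qed
    ultimately show "P 1 \<and> \<not> P 0"
      by (auto simp: one_enat_def)
  next
    assume P: "P 1 \<and> \<not> P 0"
    then have "enat 1 \<le> enat k" if "P k" for k
      using that by (cases k) auto
    with P show "mapping_index G X \<phi> = 1"
      unfolding Inf one_enat_def by (intro antisym Inf_greatest Inf_lower) auto
  qed
  then show ?thesis
    unfolding P_def .
qed


section \<open>Components of simplicial complexes\<close>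

text \<open>Two points are related if a chain of simplices joins them, that is, if they lie in the same
  connected component.\<close>

definition simplex_chain :: "'a set set \<Rightarrow> ('a \<times> 'a) set" where
  "simplex_chain K = {(x, y). \<exists>S\<in>K. x \<in> S \<and> y \<in> S}\<^sup>*"

lemma simplex_chain_refl: "(x, x) \<in> simplex_chain K"
  by (simp add: simplex_chain_def)

lemma simplex_chain_simplex: "S \<in> K \<Longrightarrow> x \<in> S \<Longrightarrow> y \<in> S \<Longrightarrow> (x, y) \<in> simplex_chain K"
  unfolding simplex_chain_def by (intro r_into_rtrancl) auto

lemma simplex_chain_trans:
  "(x, y) \<in> simplex_chain K \<Longrightarrow> (y, z) \<in> simplex_chain K \<Longrightarrow> (x, z) \<in> simplex_chain K"
  unfolding simplex_chain_def by (rule rtrancl_trans)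

lemma simplex_chain_sym: "(x, y) \<in> simplex_chain K \<Longrightarrow> (y, x) \<in> simplex_chain K"
  unfolding simplex_chain_def by (rule symD[OF sym_rtrancl]) (auto simp: sym_def)

lemma simplex_chain_constant:
  assumes "(x, y) \<in> simplex_chain K"
    and "\<And>S x y. S \<in> K \<Longrightarrow> x \<in> S \<Longrightarrow> y \<in> S \<Longrightarrow> f x = f y"
  shows "f x = f y"
  using assms(1) unfolding simplex_chain_def
  by (induction rule: rtrancl_induct) (use assms(2) in auto)

lemma simplex_chain_image:
  assumes "(x, y) \<in> simplex_chain K" and "\<And>S. S \<in> K \<Longrightarrow> f ` S \<in> K"
  shows "(f x, f y) \<in> simplex_chain K"
  using assms(1) unfolding simplex_chain_def
proof (induction rule: rtrancl_induct)
  case (step y z)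
  then obtain S where "S \<in> K" "y \<in> S" "z \<in> S" by auto
  then have "f ` S \<in> K" "f y \<in> f ` S" "f z \<in> f ` S"
    using assms(2) by simp_all
  then have "(f y, f z) \<in> {(x, y). \<exists>S\<in>K. x \<in> S \<and> y \<in> S}"
    by (intro CollectI case_prodI bexI[of _ "f ` S"] conjI)
  then show ?case
    by (rule rtrancl_into_rtrancl[OF step.IH])
qed simp

lemma simplicial_complex_connected: "simplicial_complex K \<Longrightarrow> S \<in> K \<Longrightarrow> connected S"
  unfolding simplicial_complex_def by (meson convex_connected convex_simplex)

text \<open>The preimage of any set is a union of simplices, and finitely many closed simplices have
  a closed union. The topology of \<open>Y\<close> is therefore arbitrary.\<close>

lemma continuous_map_simplicial_complex:
  assumes K: "simplicial_complex K"
    and f: "f ` \<Union>K \<subseteq> topspace Y" "\<And>S x y. S \<in> K \<Longrightarrow> x \<in> S \<Longrightarrow> y \<in> S \<Longrightarrow> f x = f y"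
  shows "continuous_map (top_of_set (\<Union>K)) Y f"
proof -
  have "closedin (top_of_set (\<Union>K)) {x \<in> \<Union>K. f x \<in> C}" for C
  proof -
    have "{x \<in> \<Union>K. f x \<in> C} = \<Union>{S \<in> K. \<exists>x\<in>S. f x \<in> C}"
    proof
      show "\<Union>{S \<in> K. \<exists>x\<in>S. f x \<in> C} \<subseteq> {x \<in> \<Union>K. f x \<in> C}"
      proof
        fix x assume "x \<in> \<Union>{S \<in> K. \<exists>x\<in>S. f x \<in> C}"
        then obtain S y where "S \<in> K" "x \<in> S" "y \<in> S" "f y \<in> C"
          by blast
        with f(2)[of S x y] show "x \<in> {x \<in> \<Union>K. f x \<in> C}"
          by auto
      qed
    qed blast
    moreover have "closed (\<Union>{S \<in> K. \<exists>x\<in>S. f x \<in> C})"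
      using K unfolding simplicial_complex_def
      by (intro closed_Union) (auto dest: closed_simplex)
    ultimately show ?thesis
      by (intro closed_subset) auto
  qed
  then show ?thesis
    using f(1) unfolding continuous_map_closedin by auto
qed

section \<open>Equivariant maps to \<open>EG G 0\<close> and stabilizers of components\<close>

lemma (in group_action) action_inv:
  assumes "g \<in> carrier G" "x \<in> E" shows "\<phi> (inv g) (\<phi> g x) = x"
proof -
  interpret group G
    using group_hom by (simp add: group_hom_def)
  have "\<phi> (inv g) (\<phi> g x) = \<phi> \<one> x"
    using composition_rule[OF assms(2) inv_closed[OF assms(1)] assms(1)] assms(1) by simp
  also have "\<dots> = x"
    using assms(2) by (simp flip: id_eq_one)
  finally show ?thesis .
qed

text \<open>With \<open>r x\<close> a chosen point in the \<open>G\<close>-orbit of the component of \<open>x\<close>, the value at \<open>x\<close> is the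
  unique \<open>g\<close> that moves the component of \<open>r x\<close> to the component of \<open>x\<close>.\<close>

lemma equivariant_map_EG_0:
  fixes K :: "'a::euclidean_space set set"
  assumes K: "free_simplicial_complex G K \<phi>"
    and free: "\<And>g x. g \<in> carrier G \<Longrightarrow> x \<in> \<Union>K \<Longrightarrow> (\<phi> g x, x) \<in> simplex_chain K \<Longrightarrow> g = \<one>\<^bsub>G\<^esub>"
  shows "\<exists>f. equivariant_map G (top_of_set (\<Union>K)) \<phi> (EG G 0) (EG_action G 0) f"
proof -
  interpret group_action G "\<Union>K" \<phi>
    using K by (simp add: free_simplicial_complex_def)
  interpret group G
    using group_hom by (simp add: group_hom_def)
  have simp: "simplicial_complex K"
    using K by (simp add: free_simplicial_complex_def)
  have img: "(\<phi> g x, \<phi> g y) \<in> simplex_chain K" if "(x, y) \<in> simplex_chain K" "g \<in> carrier G" for x y g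
    using simplex_chain_image[OF that(1)] that(2) K by (simp add: free_simplicial_complex_def)
  have one: "\<phi> \<one>\<^bsub>G\<^esub> x = x" if "x \<in> \<Union>K" for x
    using that id_eq_one by (metis restrict_apply')
  \<comment> \<open>\<open>R x\<close> collects the points with a translate in the component of
    \<open>x\<close>. As a predicate it is the same for all points of that component and of its
    translates, so the choice by \<open>SOME\<close> gives one common \<open>r x\<close>.\<close>
  define R where "R x y \<longleftrightarrow> y \<in> \<Union>K \<and> (\<exists>g\<in>carrier G. (\<phi> g y, x) \<in> simplex_chain K)" for x y
  define r where "r x = (SOME y. R x y)" for x
  define f where "f x = (SOME g. g \<in> carrier G \<and> (\<phi> g (r x), x) \<in> simplex_chain K)" for x
  have r: "R x (r x)" if "x \<in> \<Union>K" for x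
  proof -
    have "R x x"
      using one[OF that] that simplex_chain_refl unfolding R_def by (metis one_closed)
    then show ?thesis
      unfolding r_def by (rule someI)
  qed
  have f: "f x \<in> carrier G" "(\<phi> (f x) (r x), x) \<in> simplex_chain K" if "x \<in> \<Union>K" for x
  proof -
    have "\<exists>g. g \<in> carrier G \<and> (\<phi> g (r x), x) \<in> simplex_chain K"
      using r[OF that] by (auto simp: R_def)
    from someI_ex[OF this] show "f x \<in> carrier G" "(\<phi> (f x) (r x), x) \<in> simplex_chain K"
      by (simp_all add: f_def)
  qed
  \<comment> \<open>Here \<open>free\<close> enters: if \<open>g\<close> and \<open>h\<close> move
    \<open>y\<close> into the same component, then \<open>inv h \<otimes> g\<close> preserves the
    component of \<open>y\<close>.\<close>
  have unique: "g = h" if g: "g \<in> carrier G" "(\<phi> g y, x) \<in> simplex_chain K"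
    and h: "h \<in> carrier G" "(\<phi> h y, x) \<in> simplex_chain K" and y: "y \<in> \<Union>K" for g h x y
  proof -
    have "(\<phi> g y, \<phi> h y) \<in> simplex_chain K"
      using g h simplex_chain_sym simplex_chain_trans by metis
    then have "(\<phi> (inv\<^bsub>G\<^esub> h) (\<phi> g y), \<phi> (inv\<^bsub>G\<^esub> h) (\<phi> h y)) \<in> simplex_chain K"
      using h by (intro img) auto
    then have "(\<phi> (inv\<^bsub>G\<^esub> h \<otimes>\<^bsub>G\<^esub> g) y, y) \<in> simplex_chain K"
      using g h y by (simp only: composition_rule action_inv inv_closed)
    then have "inv\<^bsub>G\<^esub> h \<otimes>\<^bsub>G\<^esub> g = \<one>\<^bsub>G\<^esub>"
      using free g h y by blast
    then show ?thesis
      using g h by (metis inv_closed inv_equality inv_inv)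
  qed
  have R_cong: "R x = R x'" if "(x, x') \<in> simplex_chain K" for x x'
    using that simplex_chain_sym simplex_chain_trans unfolding R_def fun_eq_iff by metis
  have r_cong: "r x = r x'" if "(x, x') \<in> simplex_chain K" for x x'
    using R_cong[OF that] by (simp add: r_def)
  have f_cong: "f x = f x'" if xx': "(x, x') \<in> simplex_chain K" "x \<in> \<Union>K" "x' \<in> \<Union>K" for x x'
    using unique[OF f(1)[OF xx'(2)] _ f(1)[OF xx'(3)]] f(2)[OF xx'(2)] f(2)[OF xx'(3)]
      r_cong[OF xx'(1)] r[OF xx'(2)] simplex_chain_trans[OF _ xx'(1)]
    by (metis R_def)
  have act: "\<phi> g x \<in> \<Union>K" if "g \<in> carrier G" "x \<in> \<Union>K" for g x
    using element_image[OF that] by blast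
  have R_act: "R (\<phi> g x) y" if g: "g \<in> carrier G" "x \<in> \<Union>K" "R x y" for g x y
  proof -
    obtain h where h: "h \<in> carrier G" "(\<phi> h y, x) \<in> simplex_chain K" and y: "y \<in> \<Union>K"
      using g(3) by (auto simp: R_def)
    have "(\<phi> (g \<otimes>\<^bsub>G\<^esub> h) y, \<phi> g x) \<in> simplex_chain K"
      using img[OF h(2) g(1)] composition_rule[OF y g(1) h(1)] by simp
    then show ?thesis
      using y g h unfolding R_def by blast
  qed
  have r_act: "r (\<phi> g x) = r x" if g: "g \<in> carrier G" "x \<in> \<Union>K" for g x
  proof -
    \<comment> \<open>The reverse inclusion is \<open>R_act\<close> for the inverse of
      \<open>g\<close>.\<close>
    have "R x y" if "R (\<phi> g x) y" for y
      using R_act[OF inv_closed[OF g(1)] act[OF g] that] unfolding action_inv[OF g] .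
    then have "R (\<phi> g x) = R x"
      using R_act[OF g] by blast
    then show ?thesis
      by (simp add: r_def)
  qed
  have f_act: "f (\<phi> g x) = g \<otimes>\<^bsub>G\<^esub> f x" if g: "g \<in> carrier G" "x \<in> \<Union>K" for g x
  proof (rule unique[OF f(1)])
    have y: "r x \<in> \<Union>K"
      using r[OF g(2)] by (simp add: R_def)
    then show "r x \<in> \<Union>K" .
    show "(\<phi> (f (\<phi> g x)) (r x), \<phi> g x) \<in> simplex_chain K"
      using f(2)[OF act[OF g]] r_act[OF g] by simp
    show "(\<phi> (g \<otimes>\<^bsub>G\<^esub> f x) (r x), \<phi> g x) \<in> simplex_chain K"
      using img[OF f(2)[OF g(2)] g(1)] composition_rule[OF y g(1) f(1)[OF g(2)]] by simp
  qed (use g act f in auto)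
  have "continuous_map (top_of_set (\<Union>K)) (EG G 0) (EG0_point \<circ> f)"
  proof (rule continuous_map_simplicial_complex[OF simp])
    show "(EG0_point \<circ> f) ` \<Union>K \<subseteq> topspace (EG G 0)"
      using f(1) by (auto simp: EG_0)
    show "(EG0_point \<circ> f) x = (EG0_point \<circ> f) y" if "S \<in> K" "x \<in> S" "y \<in> S" for S x y
      using f_cong[OF simplex_chain_simplex[OF that] UnionI[OF that(1,2)] UnionI[OF that(1,3)]] by simp
  qed
  then have "equivariant_map G (top_of_set (\<Union>K)) \<phi> (EG G 0) (EG_action G 0) (EG0_point \<circ> f)"
    using f_act by (simp add: equivariant_map_def EG_action_EG0_point)
  then show ?thesis
    by blast
qed

section \<open>Stabilizers of components in the product\<close>

text \<open>Translating the chain from \<open>\<phi> g x\<close> to \<open>x\<close> by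
  \<open>g [^] k\<close> joins consecutive points of the orbit of \<open>x\<close>. This passes from
  arbitrary stabilizing elements to a power shared by both complexes.\<close>

lemma simplex_chain_pow:
  fixes G (structure)
  assumes K: "free_simplicial_complex G K \<phi>" and g: "g \<in> carrier G" and x: "x \<in> \<Union>K"
    and chain: "(\<phi> g x, x) \<in> simplex_chain K"
  shows "(\<phi> (g [^] (k::nat)) x, x) \<in> simplex_chain K"
proof -
  interpret group_action G "\<Union>K" \<phi>
    using K by (simp add: free_simplicial_complex_def)
  interpret group G
    using group_hom by (simp add: group_hom_def)
  show ?thesis
  proof (induction k)
    case 0
    then show ?case
      using x id_eq_one by (metis nat_pow_0 restrict_apply' simplex_chain_refl)
  next
    case (Suc k)
    have "(\<phi> (g [^] k) (\<phi> g x), \<phi> (g [^] k) x) \<in> simplex_chain K"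
      using K g by (intro simplex_chain_image[OF chain]) (simp add: free_simplicial_complex_def)
    then show ?case
      using Suc g x by (simp add: composition_rule simplex_chain_trans)
  qed
qed

text \<open>A product of two simplices is connected, so its image in a discrete space is at most one
  point. The two chains are then followed one after the other, with the other coordinate
  fixed.\<close>

lemma continuous_map_prod_discrete_simplex_chain:
  assumes K1: "simplicial_complex K1" and K2: "simplicial_complex K2"
    and f: "continuous_map (prod_topology (top_of_set (\<Union>K1)) (top_of_set (\<Union>K2))) (discrete_topology U) f"
    and x: "(x, x') \<in> simplex_chain K1" "x \<in> \<Union>K1" "x' \<in> \<Union>K1"
    and y: "(y, y') \<in> simplex_chain K2" "y \<in> \<Union>K2" "y' \<in> \<Union>K2"
  shows "f (x, y) = f (x', y')"
proof -
  have const: "f (u, v) = f (u', v')"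
    if S: "S \<in> K1" "u \<in> S" "u' \<in> S" and T: "T \<in> K2" "v \<in> T" "v' \<in> T" for S T u u' v v'
  proof -
    have "connectedin (prod_topology (top_of_set (\<Union>K1)) (top_of_set (\<Union>K2))) (S \<times> T)"
      using S T simplicial_complex_connected[OF K1 S(1)] simplicial_complex_connected[OF K2 T(1)]
      by (simp add: connectedin_Times connectedin_subtopology Union_upper Sigma_mono)
    then have "connectedin (discrete_topology U) (f ` (S \<times> T))"
      by (rule connectedin_continuous_map_image[OF f])
    then obtain c where "f ` (S \<times> T) \<subseteq> {c}"
      unfolding connectedin_discrete_topology by blast
    then show ?thesis
      using S T by (metis SigmaI imageI singletonD subsetD)
  qed
  have "f (x, y) = f (x', y)"
    using y(2) const by (intro simplex_chain_constant[OF x(1), of "\<lambda>x. f (x, y)"]) blast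
  also have "\<dots> = f (x', y')"
    using x(3) const by (intro simplex_chain_constant[OF y(1), of "\<lambda>y. f (x', y)"]) blast
  finally show ?thesis .
qed

theorem theorem1p6:
  fixes G :: "'g monoid"
    and K1 :: "'a::euclidean_space set set" and \<phi>1 :: "'g \<Rightarrow> 'a \<Rightarrow> 'a"
    and K2 :: "'b::euclidean_space set set" and \<phi>2 :: "'g \<Rightarrow> 'b \<Rightarrow> 'b"
  assumes "nice_group G"
    and "free_simplicial_complex G K1 \<phi>1"
    and "free_simplicial_complex G K2 \<phi>2"
    and "mapping_index G (top_of_set (\<Union>K1)) \<phi>1 = 1"
    and "mapping_index G (top_of_set (\<Union>K2)) \<phi>2 = 1"
  shows "mapping_index G (prod_topology (top_of_set (\<Union>K1)) (top_of_set (\<Union>K2)))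
           (diagonal_action \<phi>1 \<phi>2) = 1"
proof -
  let ?X = "prod_topology (top_of_set (\<Union>K1)) (top_of_set (\<Union>K2))"
  interpret A1: group_action G "\<Union>K1" \<phi>1
    using assms(2) by (simp add: free_simplicial_complex_def)
  interpret A2: group_action G "\<Union>K2" \<phi>2
    using assms(3) by (simp add: free_simplicial_complex_def)
  interpret group G
    using A1.group_hom by (simp add: group_hom_def)
  obtain f1 where f1: "equivariant_map G (top_of_set (\<Union>K1)) \<phi>1 (EG G 1) (EG_action G 1) f1"
    using assms(4) unfolding mapping_index_eq_1_iff by blast
  have "equivariant_map G ?X (diagonal_action \<phi>1 \<phi>2) (EG G 1) (EG_action G 1) (f1 \<circ> fst)"
    unfolding equivariant_map_def
  proof
    show "continuous_map ?X (EG G 1) (f1 \<circ> fst)"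
      using f1 unfolding equivariant_map_def
      by (intro continuous_map_compose[OF continuous_map_fst]) (rule conjunct1)
  qed (use f1 in \<open>auto simp: equivariant_map_def diagonal_action_def\<close>)
  moreover have "\<not> equivariant_map G ?X (diagonal_action \<phi>1 \<phi>2) (EG G 0) (EG_action G 0) f" for f
  proof
    assume f: "equivariant_map G ?X (diagonal_action \<phi>1 \<phi>2) (EG G 0) (EG_action G 0) f"
    \<comment> \<open>Contrapositive of \<open>equivariant_map_EG_0\<close>: without a map to
      \<open>EG G 0\<close>, a nontrivial element preserves some component.\<close>
    obtain g1 x1 where 1: "g1 \<in> carrier G" "x1 \<in> \<Union>K1" "(\<phi>1 g1 x1, x1) \<in> simplex_chain K1"
      "g1 \<noteq> \<one>\<^bsub>G\<^esub>"
      using equivariant_map_EG_0[OF assms(2)] assms(4) unfolding mapping_index_eq_1_iff by blast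
    obtain g2 x2 where 2: "g2 \<in> carrier G" "x2 \<in> \<Union>K2" "(\<phi>2 g2 x2, x2) \<in> simplex_chain K2"
      "g2 \<noteq> \<one>\<^bsub>G\<^esub>"
      using equivariant_map_EG_0[OF assms(3)] assms(5) unfolding mapping_index_eq_1_iff by blast
    obtain k1 k2 :: nat and z where z: "z \<noteq> \<one>\<^bsub>G\<^esub>" "g1 [^]\<^bsub>G\<^esub> k1 = z" "g2 [^]\<^bsub>G\<^esub> k2 = z"
      using nice_group_minimal_power[OF assms(1) 1(1) 1(4)] 1 2 by metis
    have zc: "z \<in> carrier G"
      using z(2) 1(1) by auto
    have chain: "(\<phi>1 z x1, x1) \<in> simplex_chain K1" "(\<phi>2 z x2, x2) \<in> simplex_chain K2"
      using simplex_chain_pow[OF assms(2) 1(1-3), of k1] simplex_chain_pow[OF assms(3) 2(1-3), of k2] z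
      by simp_all
    have cont: "continuous_map ?X (discrete_topology (EG0_point ` carrier G)) f"
      using f by (simp add: equivariant_map_def EG_0)
    have "f (\<phi>1 z x1, \<phi>2 z x2) = f (x1, x2)"
      using assms(2,3) A1.element_image[OF zc 1(2) refl] A2.element_image[OF zc 2(2) refl] 1(2) 2(2)
      by (intro continuous_map_prod_discrete_simplex_chain[OF _ _ cont] chain)
        (simp_all add: free_simplicial_complex_def)
    moreover have "f (\<phi>1 z x1, \<phi>2 z x2) = EG_action G 0 z (f (x1, x2))"
      using f zc 1(2) 2(2) unfolding equivariant_map_def diagonal_action_def by fastforce
    moreover obtain h where "h \<in> carrier G" "f (x1, x2) = EG0_point h"
    proof -
      have "(x1, x2) \<in> topspace ?X"
        using 1(2) 2(2) by simp
      from subsetD[OF continuous_map_image_subset_topspace[OF cont] imageI[OF this]]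
      have "f (x1, x2) \<in> EG0_point ` carrier G"
        by (simp only: topspace_discrete_topology)
      then show thesis
        by (elim imageE) (rule that)
    qed
    \<comment> \<open>Equivariance moves the value at \<open>(x1, x2)\<close> by \<open>z\<close>,
      while constancy on the component keeps it fixed; left translation by \<open>z\<close> would
      then fix \<open>h\<close>.\<close>
    ultimately have "z \<otimes>\<^bsub>G\<^esub> h = h" "h \<in> carrier G"
      by (simp_all add: EG_action_EG0_point EG0_point_inject)
    then show False
      using z(1) zc by simp
  qed
  ultimately show ?thesis
    unfolding mapping_index_eq_1_iff by blast
qed

end
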